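(* Let $V$ be any valuation ring with maximal ideal $\mathfrak m$ that is not finitely generated, and let $Z$ be the closed point of $\operatorname{Spec}(V)$. Suppose that the punctured spectrum $\operatorname{Spec}(V) - Z$ is quasi-compact (for instance if $V$ has finite Krull dimension). Then there exists a $V$-module $M$ such that $\Gamma_{\mathfrak m}(M)$ and $\Gamma_Z(\widetilde{M})$ are not isomorphic $V$-modules.
   Context: $\mathbb N$ denotes the positive integers. For an ideal $I$ of a ring $A$ and an $A$-module $M$, $\Gamma_I(M) = \{m \in M : \exists\, n \in \mathbb N \text{ such that } I^n m = 0\}$ (the $I$-torsion functor). For a topological space $X$, a closed subset $Z \subseteq X$, $U = X - Z$, and a sheaf of abelian groups $\mathcal F$ on $X$, $\Gamma_Z(\mathcal F) := \ker(\operatorname{res}^X_U : \mathcal F(X) \to \mathcal F(U))$. $\widetilde M$ denotes the quasi-coherent sheaf on $\operatorname{Spec}(V)$ associated to the $V$-module $M$; $\Gamma_Z(\widetilde M)$ is regarded as a $V$-submodule of $\widetilde M(\operatorname{Spec}(V)) = M$. *)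

theory Defs
  imports
    "HOL-Analysis.Abstract_Topology"
    "HOL-Library.Extended_Nat"
    "HOL-Algebra.Module"
    "HOL-Algebra.Ideal_Product"
    "HOL-Algebra.Divisibility"
begin

text \<open>For nonzero \<open>a\<close> and \<open>b\<close>, the element \<open>a / b\<close> of the field of fractions lies in \<open>V\<close> iff
  \<open>b\<close> divides \<open>a\<close> in \<open>V\<close>. So the condition says that \<open>x \<in> V\<close> or \<open>x\<^sup>-\<^sup>1 \<in> V\<close> for every
  \<open>x \<noteq> 0\<close> of the field of fractions. Fields count as valuation rings.\<close>

definition valuation_ring :: "('a, 'r) ring_scheme \<Rightarrow> bool" where
  "valuation_ring V \<longleftrightarrow> domain V \<and>
     (\<forall>a \<in> carrier V - {\<zero>\<^bsub>V\<^esub>}. \<forall>b \<in> carrier V - {\<zero>\<^bsub>V\<^esub>}. b divides\<^bsub>V\<^esub> a \<or> a divides\<^bsub>V\<^esub> b)"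

definition fg_ideal :: "('a, 'r) ring_scheme \<Rightarrow> 'a set \<Rightarrow> bool" where
  "fg_ideal R I \<longleftrightarrow> (\<exists>S. finite S \<and> S \<subseteq> carrier R \<and> I = Idl\<^bsub>R\<^esub> S)"

definition Spec :: "('a, 'r) ring_scheme \<Rightarrow> 'a set set" where
  "Spec R = {p. primeideal p R}"

definition zariski_open :: "('a, 'r) ring_scheme \<Rightarrow> 'a set set \<Rightarrow> bool" where
  "zariski_open R U \<longleftrightarrow> (\<exists>E \<subseteq> carrier R. U = {p \<in> Spec R. \<not> E \<subseteq> p})"

definition zariski :: "('a, 'r) ring_scheme \<Rightarrow> 'a set topology" where
  "zariski R = topology (zariski_open R)"

lemma istopology_zariski_open: "istopology (zariski_open R)"
  unfolding istopology_def
proof (intro conjI allI impI)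
  fix S T assume "zariski_open R S" "zariski_open R T"
  then obtain E F where E: "E \<subseteq> carrier R" "S = {p \<in> Spec R. \<not> E \<subseteq> p}"
    and F: "F \<subseteq> carrier R" "T = {p \<in> Spec R. \<not> F \<subseteq> p}"
    unfolding zariski_open_def by auto
  let ?G = "{e \<otimes>\<^bsub>R\<^esub> f | e f. e \<in> E \<and> f \<in> F}"
  have *: "?G \<subseteq> p \<longleftrightarrow> E \<subseteq> p \<or> F \<subseteq> p" if "p \<in> Spec R" for p
  proof -
    interpret primeideal p R using that by (simp add: Spec_def)
    show ?thesis
    proof
      assume G: "?G \<subseteq> p"
      show "E \<subseteq> p \<or> F \<subseteq> p"
      proof (rule ccontr)
        assume "\<not> (E \<subseteq> p \<or> F \<subseteq> p)"
        then obtain e f where "e \<in> E" "e \<notin> p" "f \<in> F" "f \<notin> p" by blast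
        moreover from this have "e \<otimes>\<^bsub>R\<^esub> f \<in> p" using G by blast
        ultimately show False using I_prime E(1) F(1) by blast
      qed
    next
      assume "E \<subseteq> p \<or> F \<subseteq> p"
      then show "?G \<subseteq> p" using E(1) F(1) I_l_closed I_r_closed by blast
    qed
  qed
  have sub: "?G \<subseteq> carrier R" if "S \<inter> T \<noteq> {}"
  proof -
    from that obtain p where "p \<in> Spec R" using E by auto
    then interpret primeideal p R by (simp add: Spec_def)
    show ?thesis using E(1) F(1) by blast
  qed
  show "zariski_open R (S \<inter> T)"
  proof (cases "S \<inter> T = {}")
    case True
    then show ?thesis unfolding zariski_open_def by (intro exI[of _ "{}"]) auto
  next
    case False
    have "S \<inter> T = {p \<in> Spec R. \<not> ?G \<subseteq> p}"
      using * unfolding E(2) F(2) by blast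
    then show ?thesis unfolding zariski_open_def using sub[OF False] by blast
  qed
next
  fix K assume K: "\<forall>U\<in>K. zariski_open R U"
  let ?E = "\<Union>{E. E \<subseteq> carrier R \<and> {p \<in> Spec R. \<not> E \<subseteq> p} \<in> K}"
  have "\<Union>K = {p \<in> Spec R. \<not> ?E \<subseteq> p}"
  proof (intro equalityI subsetI)
    fix p assume "p \<in> \<Union>K"
    then obtain U where U: "U \<in> K" "p \<in> U" by blast
    then obtain E where "E \<subseteq> carrier R" "U = {p \<in> Spec R. \<not> E \<subseteq> p}"
      using K unfolding zariski_open_def by meson
    then show "p \<in> {p \<in> Spec R. \<not> ?E \<subseteq> p}" using U by blast
  next
    fix p assume "p \<in> {p \<in> Spec R. \<not> ?E \<subseteq> p}"
    then obtain E where "{p \<in> Spec R. \<not> E \<subseteq> p} \<in> K" "\<not> E \<subseteq> p" "p \<in> Spec R" by blast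
    then show "p \<in> \<Union>K" by blast
  qed
  moreover have "?E \<subseteq> carrier R" by blast
  ultimately show "zariski_open R (\<Union>K)"
    unfolding zariski_open_def by blast
qed

lemma openin_zariski: "openin (zariski R) = zariski_open R"
  by (simp add: zariski_def istopology_zariski_open)

lemma topspace_zariski: "topspace (zariski R) = Spec R"
proof
  show "topspace (zariski R) \<subseteq> Spec R"
    unfolding topspace_def openin_zariski zariski_open_def by auto
  have "{p \<in> Spec R. \<not> carrier R \<subseteq> p} = Spec R"
  proof (intro equalityI subsetI CollectI conjI)
    fix p assume p: "p \<in> Spec R"
    then interpret primeideal p R by (simp add: Spec_def)
    show "\<not> carrier R \<subseteq> p" using I_notcarr a_subset by blast
  qed auto
  then have "zariski_open R (Spec R)"
    unfolding zariski_open_def by (intro exI[of _ "carrier R"]) auto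
  then show "Spec R \<subseteq> topspace (zariski R)"
    by (simp add: openin_subset openin_zariski)
qed

definition krull_dim :: "('a, 'r) ring_scheme \<Rightarrow> enat" where
  "krull_dim R = (SUP C \<in> {C. finite C \<and> C \<noteq> {} \<and> subset.chain (Spec R) C}. enat (card C - 1))"

text \<open>The library's module record extends the ring record. Only \<open>carrier\<close>, \<open>zero\<close>, \<open>add\<close> and
  \<open>smult\<close> belong to the module structure; the fields \<open>mult\<close> and \<open>one\<close> carry no meaning and
  are left \<open>undefined\<close> below.\<close>

definition module_isomorphic ::
  "('a, 'r) ring_scheme \<Rightarrow> ('a, 'b, 'm) module_scheme \<Rightarrow> ('a, 'c, 'n) module_scheme \<Rightarrow> bool" where
  "module_isomorphic R M N \<longleftrightarrow>
     (\<exists>h \<in> iso (add_monoid M) (add_monoid N).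
        \<forall>a \<in> carrier R. \<forall>x \<in> carrier M. h (a \<odot>\<^bsub>M\<^esub> x) = a \<odot>\<^bsub>N\<^esub> h x)"

text \<open>The power \<open>I\<^sup>n\<close> is taken in the multiplicative monoid of ideals of \<open>R\<close>.\<close>

definition torsion ::
  "('a, 'r) ring_scheme \<Rightarrow> 'a set \<Rightarrow> ('a, 'b, 'm) module_scheme \<Rightarrow> ('a, 'b, 'm) module_scheme" where
  "torsion R I M = M\<lparr>carrier := {x \<in> carrier M. \<exists>n::nat. n \<ge> 1 \<and>
     (\<forall>a \<in> I [^]\<^bsub>ideals_set R\<^esub> n. a \<odot>\<^bsub>M\<^esub> x = \<zero>\<^bsub>M\<^esub>)}\<rparr>"

text \<open>The localization \<open>S\<^sup>-\<^sup>1M\<close> as an \<open>R\<close>-module: fractions are classes of pairs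
  (numerator, denominator).\<close>

definition frac_rel ::
  "('a, 'r) ring_scheme \<Rightarrow> ('a, 'b, 'm) module_scheme \<Rightarrow> 'a set \<Rightarrow> (('b \<times> 'a) \<times> ('b \<times> 'a)) set" where
  "frac_rel R M S = {((x, s), (y, t)). x \<in> carrier M \<and> s \<in> S \<and> y \<in> carrier M \<and> t \<in> S \<and>
     (\<exists>u \<in> S. u \<odot>\<^bsub>M\<^esub> (t \<odot>\<^bsub>M\<^esub> x) = u \<odot>\<^bsub>M\<^esub> (s \<odot>\<^bsub>M\<^esub> y))}"

definition fraction ::
  "('a, 'r) ring_scheme \<Rightarrow> ('a, 'b, 'm) module_scheme \<Rightarrow> 'a set \<Rightarrow> 'b \<Rightarrow> 'a \<Rightarrow> ('b \<times> 'a) set" where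
  "fraction R M S x s = frac_rel R M S `` {(x, s)}"

text \<open>Each union below ranges over the representatives of the arguments; all its members
  are the same class.\<close>

definition localization ::
  "('a, 'r) ring_scheme \<Rightarrow> ('a, 'b, 'm) module_scheme \<Rightarrow> 'a set \<Rightarrow> ('a, ('b \<times> 'a) set) module" where
  "localization R M S =
    \<lparr>carrier = (carrier M \<times> S) // frac_rel R M S,
     monoid.mult = undefined,
     one = undefined,
     zero = fraction R M S \<zero>\<^bsub>M\<^esub> \<one>\<^bsub>R\<^esub>,
     add = (\<lambda>A B. \<Union>(x, s) \<in> A. \<Union>(y, t) \<in> B.
              fraction R M S (t \<odot>\<^bsub>M\<^esub> x \<oplus>\<^bsub>M\<^esub> s \<odot>\<^bsub>M\<^esub> y) (s \<otimes>\<^bsub>R\<^esub> t)),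
     smult = (\<lambda>a A. \<Union>(x, s) \<in> A. fraction R M S (a \<odot>\<^bsub>M\<^esub> x) s)\<rparr>"

abbreviation stalk ::
  "('a, 'r) ring_scheme \<Rightarrow> ('a, 'b, 'm) module_scheme \<Rightarrow> 'a set \<Rightarrow> ('a, ('b \<times> 'a) set) module" where
  "stalk R M p \<equiv> localization R M (carrier R - p)"

text \<open>Sheaves on a space with points in \<open>'p\<close>, with values in modules over a fixed ring;
  \<open>res F U W\<close> restricts sections over \<open>U\<close> to \<open>W \<subseteq> U\<close>. Sections over sets that are not
  open are irrelevant.\<close>

record ('p, 'a, 's) module_sheaf =
  sections :: "'p set \<Rightarrow> ('a, 's) module"
  res :: "'p set \<Rightarrow> 'p set \<Rightarrow> 's \<Rightarrow> 's"

text \<open>The quasi-coherent sheaf associated to \<open>M\<close>: sections over \<open>U\<close> are the functions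
  \<open>s\<close> on \<open>U\<close> with \<open>s p \<in> M\<^sub>p\<close> that locally have the form \<open>x / f\<close>.\<close>

definition tilde ::
  "('a, 'r) ring_scheme \<Rightarrow> ('a, 'b, 'm) module_scheme \<Rightarrow>
   ('a set, 'a, 'a set \<Rightarrow> ('b \<times> 'a) set) module_sheaf" where
  "tilde R M =
    \<lparr>sections = (\<lambda>U.
       \<lparr>carrier = {s \<in> (\<Pi>\<^sub>E p\<in>U. carrier (stalk R M p)).
          \<forall>p\<in>U. \<exists>W. openin (zariski R) W \<and> p \<in> W \<and> W \<subseteq> U \<and>
            (\<exists>x \<in> carrier M. \<exists>f \<in> carrier R. \<forall>q\<in>W. f \<notin> q \<and>
               s q = fraction R M (carrier R - q) x f)},
        monoid.mult = undefined,
        one = undefined,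
        zero = (\<lambda>p\<in>U. \<zero>\<^bsub>stalk R M p\<^esub>),
        add = (\<lambda>s t. \<lambda>p\<in>U. s p \<oplus>\<^bsub>stalk R M p\<^esub> t p),
        smult = (\<lambda>a s. \<lambda>p\<in>U. a \<odot>\<^bsub>stalk R M p\<^esub> s p)\<rparr>),
     res = (\<lambda>U W s. restrict s W)\<rparr>"

text \<open>The submodule of global sections of \<open>F\<close> supported in \<open>Z\<close>, i.e. the kernel of the
  restriction to the complement of \<open>Z\<close>.\<close>

definition sections_supported_in ::
  "'p topology \<Rightarrow> 'p set \<Rightarrow> ('p, 'a, 's) module_sheaf \<Rightarrow> ('a, 's) module" where
  "sections_supported_in X Z F =
     (let G = sections F (topspace X); H = sections F (topspace X - Z)
      in G\<lparr>carrier := a_kernel G H (res F (topspace X) (topspace X - Z))\<rparr>)"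

end

theory Submission
  imports Defs "HOL-Algebra.QuotRing"
begin

text \<open>Since \<open>\<mm>\<close> is not principal, \<open>\<mm>\<^sup>2 = \<mm>\<close>, so the \<open>\<mm>\<close>-torsion of any module is killed
  by \<open>\<mm>\<close>. Quasi-compactness of the punctured spectrum, together with the total order of the basic
  open sets, yields a single \<open>f \<in> \<mm>\<close> lying in no other prime. For \<open>M = V/fV\<close> every section
  vanishes off the closed point. If \<open>\<Gamma>\<^sub>Z\<close> were isomorphic to the \<open>\<mm>\<close>-torsion, \<open>\<mm>\<close> would
  kill the global section \<open>1\<close>, whence \<open>\<mm> = fV\<close>, which is finitely generated. In finite
  dimension the spectrum, being a chain, is itself finite.\<close>

section \<open>Ideals of a valuation ring\<close>

text \<open>The defining comparison concerns nonzero elements; it extends to zero because everything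
  divides zero.\<close>

lemma valuation_ring_divides_total:
  fixes V (structure)
  assumes "valuation_ring V" "a \<in> carrier V" "b \<in> carrier V"
  shows "a divides b \<or> b divides a"
proof -
  interpret domain V using assms(1) by (simp add: valuation_ring_def)
  have "c divides \<zero>" if "c \<in> carrier V" for c
    using that by (intro dividesI[of \<zero>]) auto
  then show ?thesis using assms unfolding valuation_ring_def by blast
qed

lemma ideal_divides_closed:
  fixes R (structure)
  assumes "ideal I R" "a \<in> I" "a divides b"
  shows "b \<in> I"
  using assms by (auto intro: ideal.I_r_closed)

text \<open>If \<open>x\<close> lay only in \<open>I\<close> and \<open>y\<close> only in
  \<open>J\<close>, one would divide the other and thereby pull it into its own ideal.\<close>

lemma valuation_ring_ideals_total:
  assumes V: "valuation_ring V" and I: "ideal I V" and J: "ideal J V"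
  shows "I \<subseteq> J \<or> J \<subseteq> I"
  using valuation_ring_divides_total[OF V] ideal_divides_closed[OF I] ideal_divides_closed[OF J]
    ideal.Icarr[OF I] ideal.Icarr[OF J] by (meson subsetI)

text \<open>Comparability leaves only the case \<open>\<mm> \<subseteq> I\<close>, where maximality
  forces \<open>I = \<mm>\<close>. Thus \<open>V\<close> is local.\<close>

lemma valuation_ring_ideal_le_maximal:
  assumes V: "valuation_ring V" and m: "maximalideal \<mm> V"
    and I: "ideal I V" "I \<noteq> carrier V"
  shows "I \<subseteq> \<mm>"
proof -
  interpret maximalideal \<mm> V by (rule m)
  have "I \<subseteq> carrier V" using ideal.Icarr[OF I(1)] by blast
  then show ?thesis
    using valuation_ring_ideals_total[OF V I(1) is_ideal] I_maximal[OF I(1)] I(2) by blast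
qed

text \<open>The principal ideal of \<open>a\<close> does not lie in \<open>\<mm>\<close>, so it is
  all of \<open>V\<close>.\<close>

lemma valuation_ring_unit_if_notin_maximal:
  fixes V (structure)
  assumes V: "valuation_ring V" and m: "maximalideal \<mm> V"
    and a: "a \<in> carrier V" "a \<notin> \<mm>"
  shows "a \<in> Units V"
proof -
  interpret domain V using V by (simp add: valuation_ring_def)
  have "\<one> \<in> PIdl a"
    using valuation_ring_ideal_le_maximal[OF V m cgenideal_ideal[OF a(1)]] cgenideal_self[OF a(1)] a(2)
    by blast
  then obtain x where "x \<in> carrier V" "\<one> = x \<otimes> a" by (auto simp: cgenideal_def)
  then show ?thesis using a(1) m_comm[of x a] by (auto simp: Units_def)
qed

lemma fg_ideal_cgenideal:
  fixes R (structure)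
  assumes "cring R" "a \<in> carrier R"
  shows "fg_ideal R (PIdl a)"
  using cring.cgenideal_eq_genideal[OF assms] assms(2) unfolding fg_ideal_def
  by (intro exI[of _ "{a}"]) auto

text \<open>No \<open>x\<close> in \<open>\<mm>\<close> generates \<open>\<mm>\<close>, so some
  \<open>y\<close> in \<open>\<mm>\<close> is no multiple of \<open>x\<close>. Then
  \<open>x = y \<otimes> c\<close>, and \<open>c\<close> lies in \<open>\<mm>\<close> because a unit
  \<open>c\<close> would make \<open>x\<close> divide \<open>y\<close>.\<close>

lemma valuation_ring_maximal_idempotent:
  fixes V (structure)
  assumes V: "valuation_ring V" and m: "maximalideal \<mm> V" and nfg: "\<not> fg_ideal V \<mm>"
  shows "\<mm> \<cdot> \<mm> = \<mm>"
proof
  interpret domain V using V by (simp add: valuation_ring_def)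
  interpret m: maximalideal \<mm> V by (rule m)
  show "\<mm> \<cdot> \<mm> \<subseteq> \<mm>"
    using ideal_prod_inter[OF m.is_ideal m.is_ideal] by simp
  show "\<mm> \<subseteq> \<mm> \<cdot> \<mm>"
  proof
    fix x assume x: "x \<in> \<mm>"
    then have xc: "x \<in> carrier V" by (rule m.Icarr)
    have "\<mm> \<noteq> PIdl x" using nfg fg_ideal_cgenideal[OF is_cring xc] by auto
    moreover have "PIdl x \<subseteq> \<mm>" by (rule cgenideal_minimal[OF m.is_ideal x])
    ultimately obtain y where y: "y \<in> \<mm>" "y \<notin> PIdl x" by blast
    then have yc: "y \<in> carrier V" by (simp add: m.Icarr)
    have nd: "\<not> x divides y"
      using y(2) ideal_divides_closed[OF cgenideal_ideal[OF xc] cgenideal_self[OF xc]] by blast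
    with valuation_ring_divides_total[OF V xc yc] obtain c
      where c: "c \<in> carrier V" "x = y \<otimes> c" by (auto simp: factor_def)
    have "c \<in> \<mm>"
    proof (rule ccontr)
      assume "c \<notin> \<mm>"
      then have u: "c \<in> Units V" by (rule valuation_ring_unit_if_notin_maximal[OF V m c(1)])
      then have "y = x \<otimes> inv c" using c yc by (simp add: m_assoc)
      then show False using nd u by auto
    qed
    then show "x \<in> \<mm> \<cdot> \<mm>" using y(1) c(2) by (auto intro: ideal_prod.prod)
  qed
qed

lemma ideal_pow_idempotent:
  fixes R (structure)
  assumes R: "cring R" and I: "ideal I R" "I \<cdot> I = I" and n: "n \<ge> (1::nat)"
  shows "I [^]\<^bsub>ideals_set R\<^esub> n = I"
proof -
  interpret cring R by (rule R)
  interpret comm_monoid "ideals_set R" by (rule ideals_set_is_comm_monoid)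
  have Ic: "I \<in> carrier (ideals_set R)" using I(1) by (simp add: ideals_set_def)
  \<comment> \<open>The induction starts at 1, since the zeroth power is the whole ring.\<close>
  show ?thesis using n
  proof (induction n rule: dec_induct)
    case base
    show ?case using l_one[OF Ic] by (simp add: nat_pow_def)
  next
    case (step k)
    then show ?case using I(2) by (simp add: ideals_set_def)
  qed
qed

section \<open>The punctured spectrum\<close>

lemma valuation_ring_finite_Spec:
  assumes V: "valuation_ring V" and dim: "krull_dim V < \<infinity>"
  shows "finite (Spec V)"
proof (rule ccontr)
  assume inf: "infinite (Spec V)"
  obtain d where d: "krull_dim V = enat d" using dim by (cases "krull_dim V") auto
  \<comment> \<open>These \<open>d + 2\<close> primes are pairwise comparable, so they form a chain
    of length \<open>d + 1\<close>, one more than the dimension allows.\<close>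
  obtain C where C: "C \<subseteq> Spec V" "finite C" "card C = d + 2"
    using infinite_arbitrarily_large[OF inf] by blast
  have "subset.chain (Spec V) C"
    unfolding subset_chain_def
  proof (intro conjI ballI)
    fix I J assume "I \<in> C" "J \<in> C"
    then have "ideal I V" "ideal J V" using C(1) by (auto simp: Spec_def primeideal_def)
    then show "I \<subseteq> J \<or> J \<subseteq> I" by (rule valuation_ring_ideals_total[OF V])
  qed (rule C(1))
  moreover have "C \<noteq> {}" using C by auto
  ultimately have "enat (card C - 1) \<le> krull_dim V"
    unfolding krull_dim_def using C(2) by (intro SUP_upper) auto
  then show False using C(3) d by simp
qed

lemma valuation_ring_principal_support:
  assumes V: "valuation_ring V" and m: "maximalideal \<mm> V"
    and comp: "compactin (zariski V) (Spec V - {\<mm>})"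
  obtains f where "f \<in> \<mm>" "\<And>p. p \<in> Spec V \<Longrightarrow> p \<noteq> \<mm> \<Longrightarrow> f \<notin> p"
proof -
  interpret maximalideal \<mm> V by (rule m)
  define D where "D f = {p \<in> Spec V. f \<notin> p}" for f
  have "openin (zariski V) (D f)" if "f \<in> \<mm>" for f
    unfolding openin_zariski zariski_open_def D_def
    using Icarr[OF that] by (intro exI[of _ "{f}"]) auto
  \<comment> \<open>A prime other than \<open>\<mm>\<close> is properly contained in
    \<open>\<mm>\<close>, hence misses some element of it.\<close>
  moreover have "Spec V - {\<mm>} \<subseteq> \<Union> (D ` \<mm>)"
  proof
    fix p assume p: "p \<in> Spec V - {\<mm>}"
    then interpret p: primeideal p V by (simp add: Spec_def)
    have "p \<subseteq> \<mm>"
      using valuation_ring_ideal_le_maximal[OF V m p.is_ideal] p.I_notcarr by blast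
    then show "p \<in> \<Union> (D ` \<mm>)" using p by (auto simp: D_def)
  qed
  ultimately obtain \<F> where \<F>: "finite \<F>" "\<F> \<subseteq> D ` \<mm>" "Spec V - {\<mm>} \<subseteq> \<Union>\<F>"
    using comp unfolding compactin_def by (metis (no_types, lifting) imageE)
  show thesis
  proof (cases "\<F> = {}")
    case True
    \<comment> \<open>An empty subcover leaves no prime but \<open>\<mm>\<close>, so any element of
      \<open>\<mm>\<close> serves; zero is taken.\<close>
    then show thesis using that[of "\<zero>\<^bsub>V\<^esub>"] \<F>(3) by auto
  next
    case False
    have "subset.chain (D ` \<mm>) \<F>"
      unfolding subset_chain_def
    proof (intro conjI ballI)
      fix A B assume "A \<in> \<F>" "B \<in> \<F>"
      then obtain a b where ab: "a \<in> \<mm>" "b \<in> \<mm>" "A = D a" "B = D b" using \<F>(2) by blast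
      \<comment> \<open>Divisibility reverses inclusion of these open sets, so they are totally
        ordered.\<close>
      have "D y \<subseteq> D x" if "x divides\<^bsub>V\<^esub> y" for x y
        using ideal_divides_closed[OF _ _ that] by (auto simp: D_def Spec_def primeideal_def)
      then show "A \<subseteq> B \<or> B \<subseteq> A"
        using valuation_ring_divides_total[OF V Icarr[OF ab(1)] Icarr[OF ab(2)]] ab(3,4) by metis
    qed (rule \<F>(2))
    \<comment> \<open>A finite nonempty chain contains its own union, so a single \<open>D f\<close>
      covers.\<close>
    then have "\<Union>\<F> \<in> \<F>" using Union_in_chain \<F>(1) False by blast
    then obtain f where "f \<in> \<mm>" "\<Union>\<F> = D f" using \<F>(2) by blast
    then show thesis using that[of f] \<F>(3) by (auto simp: D_def)
  qed
qed

section \<open>Cyclic modules\<close>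

text \<open>Addition and coset product are those of the factor ring, so the module laws come from
  ring laws.\<close>

definition quotient_module :: "('a, 'r) ring_scheme \<Rightarrow> 'a set \<Rightarrow> ('a, 'a set) module" where
  "quotient_module R I =
    \<lparr>carrier = carrier (R Quot I), monoid.mult = undefined, one = undefined,
     zero = I, add = set_add R, smult = (\<lambda>a X. rcoset_mult R I (I +>\<^bsub>R\<^esub> a) X)\<rparr>"

lemma module_quotient_module:
  fixes R (structure)
  assumes R: "cring R" and I: "ideal I R"
  shows "Module.module R (quotient_module R I)"
proof -
  interpret cring R by (rule R)
  interpret I: ideal I R by (rule I)
  interpret Q: cring "R Quot I" by (rule I.quotient_is_cring[OF R])
  have "abelian_group (quotient_module R I)"
    using Q.a_assoc Q.a_comm Q.l_zero Q.add.l_inv_ex Q.zero_closed Q.a_closed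
    by (intro abelian_groupI) (simp_all add: quotient_module_def FactRing_def)
  then show ?thesis
    by (intro moduleI[OF R])
      (auto simp: quotient_module_def FactRing_simps I.rcoset_mult_add I.a_rcos_sum l_distr r_distr m_assoc)
qed

lemma quotient_module_smult_coset:
  fixes R (structure)
  assumes "ideal I R" "a \<in> carrier R" "b \<in> carrier R"
  shows "a \<odot>\<^bsub>quotient_module R I\<^esub> (I +> b) = I +> (a \<otimes> b)"
  using ideal.rcoset_mult_add[OF assms] by (simp add: quotient_module_def)

lemma quotient_module_coset_eq_zero_iff:
  fixes R (structure)
  assumes "ideal I R" "a \<in> carrier R"
  shows "I +> a = \<zero>\<^bsub>quotient_module R I\<^esub> \<longleftrightarrow> a \<in> I"
proof -
  interpret ideal I R by (rule assms(1))
  show ?thesis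
    using a_rcos_const[of a] rcos_const_imp_mem[OF assms(2)] by (auto simp: quotient_module_def)
qed

lemma carrier_quotient_module:
  fixes R (structure)
  shows "carrier (quotient_module R I) = {I +> a | a. a \<in> carrier R}"
  by (auto simp: quotient_module_def FactRing_simps)

section \<open>Fractions, global sections and torsion\<close>

lemma fraction_eq_Times_if_annihilated:
  assumes M: "Module.module R M" and u: "u \<in> S" "\<And>y. y \<in> carrier M \<Longrightarrow> u \<odot>\<^bsub>M\<^esub> y = \<zero>\<^bsub>M\<^esub>"
    and S: "S \<subseteq> carrier R" and x: "x \<in> carrier M" and s: "s \<in> S"
  shows "fraction R M S x s = carrier M \<times> S"
proof -
  interpret Module.module R M by (rule M)
  \<comment> \<open>The denominator \<open>u\<close> kills \<open>M\<close>, so it makes both sides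
    of the fraction relation zero and identifies all pairs: the localization vanishes.\<close>
  show ?thesis
    using u S x s unfolding fraction_def frac_rel_def
    by (auto simp: subset_iff intro!: bexI[OF _ u(1)])
qed

text \<open>This is the section \<open>x / 1\<close>; the whole spectrum serves as the neighbourhood
  of every point.\<close>

lemma tilde_fraction_section:
  assumes x: "x \<in> carrier M" and R: "cring R"
  shows "(\<lambda>p\<in>Spec R. fraction R M (carrier R - p) x \<one>\<^bsub>R\<^esub>)
           \<in> carrier (sections (tilde R M) (Spec R))"
proof -
  interpret cring R by (rule R)
  have one: "\<one>\<^bsub>R\<^esub> \<in> carrier R - p" if "p \<in> Spec R" for p
    using that ideal.one_imp_carrier[of p R] by (auto simp: Spec_def primeideal_def primeideal_axioms_def)
  have "openin (zariski R) (Spec R)"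
    using openin_topspace[of "zariski R"] by (simp add: topspace_zariski)
  then show ?thesis
    using one x unfolding tilde_def localization_def fraction_def
    by (auto intro!: quotientI exI[of _ "Spec R"] bexI[of _ x] bexI[of _ "\<one>\<^bsub>R\<^esub>"])
qed

text \<open>The two unions defining the scalar products are compared directly: only reflexivity of the
  equivalence of fractions enters.\<close>

lemma localization_smult_fraction_eq_null:
  fixes R (structure)
  assumes M: "Module.module R M" and S: "S \<subseteq> carrier R" "\<one> \<in> S"
    and a: "a \<in> carrier R" and x: "x \<in> carrier M"
    and eq: "a \<odot>\<^bsub>localization R M S\<^esub> fraction R M S x \<one> =
             \<zero> \<odot>\<^bsub>localization R M S\<^esub> fraction R M S x \<one>"
  obtains u t where "u \<in> S" "t \<in> S" "u \<odot>\<^bsub>M\<^esub> (t \<odot>\<^bsub>M\<^esub> (a \<odot>\<^bsub>M\<^esub> x)) = \<zero>\<^bsub>M\<^esub>"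
proof -
  interpret Module.module R M by (rule M)
  have refl: "(y, \<one>) \<in> fraction R M S y \<one>" if "y \<in> carrier M" for y
    using that S unfolding fraction_def frac_rel_def by auto
  \<comment> \<open>The representative \<open>(x, \<one>)\<close> puts this pair into the left
    union; by \<open>eq\<close> it also arises on the right, from some
    \<open>(y, t)\<close>.\<close>
  have "(a \<odot>\<^bsub>M\<^esub> x, \<one>) \<in> a \<odot>\<^bsub>localization R M S\<^esub> fraction R M S x \<one>"
    using refl[OF x] refl[of "a \<odot>\<^bsub>M\<^esub> x"] a x unfolding localization_def by auto
  then obtain y t where y: "(y, t) \<in> fraction R M S x \<one>"
    and f: "(a \<odot>\<^bsub>M\<^esub> x, \<one>) \<in> fraction R M S (\<zero> \<odot>\<^bsub>M\<^esub> y) t"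
    unfolding eq by (auto simp: localization_def)
  from y have yc: "y \<in> carrier M" and t: "t \<in> S" by (auto simp: fraction_def frac_rel_def)
  from f obtain u where u: "u \<in> S"
    "u \<odot>\<^bsub>M\<^esub> (\<one> \<odot>\<^bsub>M\<^esub> (\<zero> \<odot>\<^bsub>M\<^esub> y)) = u \<odot>\<^bsub>M\<^esub> (t \<odot>\<^bsub>M\<^esub> (a \<odot>\<^bsub>M\<^esub> x))"
    by (auto simp: fraction_def frac_rel_def)
  moreover have "u \<odot>\<^bsub>M\<^esub> (\<one> \<odot>\<^bsub>M\<^esub> (\<zero> \<odot>\<^bsub>M\<^esub> y)) = \<zero>\<^bsub>M\<^esub>"
    using yc u(1) S by auto
  ultimately show thesis using that t by metis
qed

text \<open>\<open>N\<close> is a bare record here, so \<open>\<zero> \<odot> s\<close> stands in for its zero.\<close>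

lemma module_isomorphic_torsion_smult:
  fixes R (structure)
  assumes M: "Module.module R M" and I: "ideal I R" "I \<cdot> I = I"
    and iso: "module_isomorphic R (torsion R I M) N"
    and a: "a \<in> I" and s: "s \<in> carrier N"
  shows "a \<odot>\<^bsub>N\<^esub> s = \<zero> \<odot>\<^bsub>N\<^esub> s"
proof -
  interpret Module.module R M by (rule M)
  interpret I: ideal I R by (rule I(1))
  let ?T = "torsion R I M"
  obtain h where h: "h \<in> iso (add_monoid ?T) (add_monoid N)"
    and lin: "\<And>b x. b \<in> carrier R \<Longrightarrow> x \<in> carrier ?T \<Longrightarrow> h (b \<odot>\<^bsub>?T\<^esub> x) = b \<odot>\<^bsub>N\<^esub> h x"
    using iso unfolding module_isomorphic_def by blast
  from h s obtain x where x: "x \<in> carrier ?T" "s = h x"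
    by (auto simp: iso_def bij_betw_def)
  \<comment> \<open>By idempotence every positive power of \<open>I\<close> is \<open>I\<close>, so
    torsion elements are killed by \<open>I\<close> itself.\<close>
  have x0: "b \<odot>\<^bsub>?T\<^esub> x = \<zero>\<^bsub>M\<^esub>" if "b \<in> I" for b
    using x(1) that ideal_pow_idempotent[OF R.is_cring I] by (auto simp: torsion_def)
  \<comment> \<open>Both \<open>a\<close> and \<open>\<zero>\<close> lie in \<open>I\<close>, so
    both sides are the image under \<open>h\<close> of the zero of \<open>M\<close>.\<close>
  show ?thesis
    using lin[OF _ x(1), of a] lin[OF _ x(1), of \<zero>] x0[OF a] x0[of \<zero>] I.Icarr[OF a] x(2) by simp
qed

section \<open>The counterexample \<open>V/fV\<close>\<close>

lemma valuation_ring_quotient_not_isomorphic: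
  fixes V (structure)
  assumes V: "valuation_ring V" and m: "maximalideal \<mm> V" and nfg: "\<not> fg_ideal V \<mm>"
    and f: "f \<in> \<mm>" "\<And>p. p \<in> Spec V \<Longrightarrow> p \<noteq> \<mm> \<Longrightarrow> f \<notin> p"
  defines "M \<equiv> quotient_module V (PIdl f)"
  shows "\<not> module_isomorphic V (torsion V \<mm> M)
            (sections_supported_in (zariski V) {\<mm>} (tilde V M))"
proof
  let ?N = "sections_supported_in (zariski V) {\<mm>} (tilde V M)"
  assume iso: "module_isomorphic V (torsion V \<mm> M) ?N"
  interpret domain V using V by (simp add: valuation_ring_def)
  interpret m: maximalideal \<mm> V by (rule m)
  have fc: "f \<in> carrier V" using f(1) by (rule m.Icarr)
  let ?I = "PIdl f"
  have I: "ideal ?I V" by (rule cgenideal_ideal[OF fc])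
  have M: "Module.module V M" unfolding M_def by (rule module_quotient_module[OF is_cring I])
  interpret M: Module.module V M by (rule M)
  \<comment> \<open>The class of 1 is the test element because its annihilator is exactly
    \<open>fV\<close>.\<close>
  define e where "e = ?I +> \<one>"
  have e: "e \<in> carrier M" by (auto simp: e_def M_def carrier_quotient_module)
  have kill: "f \<odot>\<^bsub>M\<^esub> y = \<zero>\<^bsub>M\<^esub>" if "y \<in> carrier M" for y
  proof -
    from that obtain b where b: "b \<in> carrier V" "y = ?I +> b"
      by (auto simp: M_def carrier_quotient_module)
    have "f \<otimes> b \<in> ?I" using ideal.I_r_closed[OF I cgenideal_self[OF fc] b(1)] .
    then show ?thesis
      using b fc by (simp add: M_def quotient_module_smult_coset[OF I] quotient_module_coset_eq_zero_iff[OF I])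
  qed
  have mS: "\<mm> \<in> Spec V" using maximalideal_prime[OF m] by (simp add: Spec_def)
  have one: "\<one> \<in> carrier V - p" if "p \<in> Spec V" for p
    using that ideal.one_imp_carrier[of p V] by (auto simp: Spec_def primeideal_def primeideal_axioms_def)
  define s where "s = (\<lambda>p\<in>Spec V. fraction V M (carrier V - p) e \<one>)"
  \<comment> \<open>Off the closed point \<open>f\<close> is an admissible denominator that kills
    \<open>M\<close>, so \<open>e / 1 = 0 / 1\<close> there.\<close>
  have "fraction V M (carrier V - p) e \<one> = fraction V M (carrier V - p) \<zero>\<^bsub>M\<^esub> \<one>"
    if "p \<in> Spec V - {\<mm>}" for p
  proof -
    have "fraction V M (carrier V - p) y \<one> = carrier M \<times> (carrier V - p)" if "y \<in> carrier M" for y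
      using \<open>p \<in> Spec V - {\<mm>}\<close> f(2) fc kill one that
      by (intro fraction_eq_Times_if_annihilated[OF M, of f]) auto
    then show ?thesis using e by simp
  qed
  then have "res (tilde V M) (Spec V) (Spec V - {\<mm>}) s = \<zero>\<^bsub>sections (tilde V M) (Spec V - {\<mm>})\<^esub>"
    by (auto simp: tilde_def localization_def s_def restrict_def fun_eq_iff)
  then have sN: "s \<in> carrier ?N"
    using tilde_fraction_section[OF e is_cring]
    by (simp add: sections_supported_in_def topspace_zariski Let_def a_kernel_def' s_def)
  have "\<mm> \<subseteq> ?I"
  proof
    fix a assume a: "a \<in> \<mm>"
    then have ac: "a \<in> carrier V" by (rule m.Icarr)
    have "a \<odot>\<^bsub>?N\<^esub> s = \<zero> \<odot>\<^bsub>?N\<^esub> s"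
      by (rule module_isomorphic_torsion_smult[OF M m.is_ideal
            valuation_ring_maximal_idempotent[OF V m nfg] iso a sN])
    \<comment> \<open>Evaluation at the closed point loses nothing: the denominators there are
      units.\<close>
    then have "(a \<odot>\<^bsub>?N\<^esub> s) \<mm> = (\<zero> \<odot>\<^bsub>?N\<^esub> s) \<mm>" by simp
    then have "a \<odot>\<^bsub>stalk V M \<mm>\<^esub> fraction V M (carrier V - \<mm>) e \<one> =
        \<zero> \<odot>\<^bsub>stalk V M \<mm>\<^esub> fraction V M (carrier V - \<mm>) e \<one>"
      using mS by (simp add: sections_supported_in_def topspace_zariski Let_def tilde_def s_def)
    then obtain u t where ut: "u \<in> carrier V - \<mm>" "t \<in> carrier V - \<mm>"
      and z: "u \<odot>\<^bsub>M\<^esub> (t \<odot>\<^bsub>M\<^esub> (a \<odot>\<^bsub>M\<^esub> e)) = \<zero>\<^bsub>M\<^esub>"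
      using localization_smult_fraction_eq_null[OF M _ one[OF mS] ac e] by auto
    have U: "u \<in> Units V" "t \<in> Units V"
      using ut valuation_ring_unit_if_notin_maximal[OF V m] by auto
    from z have "u \<otimes> (t \<otimes> a) \<in> ?I"
      using ut ac unfolding M_def e_def
      by (simp add: quotient_module_smult_coset[OF I] quotient_module_coset_eq_zero_iff[OF I])
    \<comment> \<open>Cancelling \<open>u\<close> and \<open>t\<close> leaves \<open>a\<close>
      itself in the ideal.\<close>
    then have "inv t \<otimes> (inv u \<otimes> (u \<otimes> (t \<otimes> a))) \<in> ?I"
      using ideal.I_l_closed[OF I ideal.I_l_closed[OF I _ Units_inv_closed[OF U(1)]] Units_inv_closed[OF U(2)]]
      by blast
    moreover have "inv x \<otimes> (x \<otimes> y) = y" if "x \<in> Units V" "y \<in> carrier V" for x y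
      using that m_assoc[of "inv x" x y] by (simp add: Units_closed)
    ultimately show "a \<in> ?I" using U ac by (simp add: Units_closed)
  qed
  then have "\<mm> = ?I" using cgenideal_minimal[OF m.is_ideal f(1)] by blast
  then show False using nfg fg_ideal_cgenideal[OF is_cring fc] by simp
qed

theorem proposition6p5:
  fixes V :: "('a, 'r) ring_scheme" and \<mm> :: "'a set"
  assumes "valuation_ring V"
    and "maximalideal \<mm> V"
    and "\<not> fg_ideal V \<mm>"
  shows "(krull_dim V < \<infinity> \<longrightarrow> compactin (zariski V) (Spec V - {\<mm>})) \<and>
    (compactin (zariski V) (Spec V - {\<mm>}) \<longrightarrow>
      (\<exists>M :: ('a, 'a set) module. Module.module V M \<and>
        \<not> module_isomorphic V (torsion V \<mm> M)
            (sections_supported_in (zariski V) {\<mm>} (tilde V M))))"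
proof (intro conjI impI)
  assume "krull_dim V < \<infinity>"
  then have "finite (Spec V)" by (rule valuation_ring_finite_Spec[OF assms(1)])
  then show "compactin (zariski V) (Spec V - {\<mm>})"
    by (intro finite_imp_compactin) (auto simp: topspace_zariski)
next
  interpret domain V using assms(1) by (simp add: valuation_ring_def)
  assume "compactin (zariski V) (Spec V - {\<mm>})"
  then obtain f where f: "f \<in> \<mm>" "\<And>p. p \<in> Spec V \<Longrightarrow> p \<noteq> \<mm> \<Longrightarrow> f \<notin> p"
    using valuation_ring_principal_support[OF assms(1,2)] by blast
  have "f \<in> carrier V"
    using f(1) assms(2) by (auto simp: maximalideal_def dest: ideal.Icarr)
  \<comment> \<open>The witness \<open>V/fV\<close> consists of cosets, which matches the type
    \<open>'a set\<close> of the elements of \<open>M\<close>.\<close>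
  then have "Module.module V (quotient_module V (PIdl\<^bsub>V\<^esub> f))"
    by (intro module_quotient_module is_cring cgenideal_ideal)
  with valuation_ring_quotient_not_isomorphic[OF assms f]
  show "\<exists>M :: ('a, 'a set) module. Module.module V M \<and>
        \<not> module_isomorphic V (torsion V \<mm> M)
            (sections_supported_in (zariski V) {\<mm>} (tilde V M))" by blast
qed

end
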